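(* Let $d>1$ and, for real constants $b$, $l_{i,j}$ ($1\le i,j\le d$), $s_i$ ($1\le i\le d$), let $$\alpha_{i,j}=x_j(x_i-l_{i,j})\ (i\ne j),\qquad \beta_i=-x_i\sum_{k=1}^dx_k+\sum_{k=1}^dl_{i,k}x_k+bx_i+s_i,\qquad \gamma_i=x_i\Big(-\sum_{k=1}^dx_k+\sum_{k=1}^dl_{k,i}\Big).$$ The solutions of the compatibility conditions, that is, those polynomials $\alpha_{i,j}=x_j(x_i-l_{i,j})$ ($i\ne j$), $\beta_i=-x_i\sum_{k=1}^dx_k+\sum_{k=1}^dl_{i,k}x_k+bx_i+s_i$, $\gamma_i=x_i\big(-\sum_{k=1}^dx_k+\sum_{k=1}^dl_{k,i}\big)$, with real constants $b$, $l_{i,j}$, $s_i$, which satisfy, for all $1\le i\neq j\le d$, the polynomial identities $$\alpha_{i,j}(x-e_i)\beta_j(x-e_j)\gamma_i(x)=\alpha_{j,i}(x-e_j)\beta_i(x-e_i)\gamma_j(x),$$ $$\beta_i(x-e_i)\beta_j(x-e_i-e_j)\gamma_j(x)\gamma_i(x-e_j)=\beta_j(x-e_j)\beta_i(x-e_i-e_j)\gamma_i(x)\gamma_j(x-e_i),$$ are exactly the following two families. Solution 1: $$\alpha_{i,j}=x_j(x_i-l_i),\quad \beta_i=-(x_i-l_i)\Big(\sum_{k=1}^dx_k-b-r\Big),\quad \gamma_i=-x_i\Big(\sum_{k=1}^dx_k-\sum_{k=1}^dl_k-r\Big),$$ where $b$, $r$ and $\{l_i\}_{i=1}^d$ are free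 parameters. Solution 2: $$\alpha_{i,j}=x_j(x_i-l_i),\quad \beta_i=-(x_i-l_i)\Big(\sum_{k=1}^dx_k-\sum_{k=1}^dl_k+1-r_i\Big),\quad \gamma_i=-x_i\Big(\sum_{k=1}^dx_k-\sum_{k=1}^dl_k-r_i\Big),$$ where $\{l_i,r_i\}_{i=1}^d$ are free parameters and $b=\sum_{k=1}^dl_k-1$.
   Context: $x=(x_1,\dots,x_d)$, $\{e_1,\dots,e_d\}$ is the standard basis of $\mathbb{R}^d$. The $\alpha_{i,j},\beta_i,\gamma_i$ are the coefficients of the difference operator $D=\sum_{i\ne j}\alpha_{i,j}E_iE_j^{-1}+\sum_i\beta_iE_i+\sum_i\gamma_iE_i^{-1}+\delta\,\mathrm{Id}$, where $E_if(x)=f(x+e_i)$. The given form is the one with normalization $a=-1$ (quadratic eigenvalue). The constant $b$ is the same in the general form and in the two solutions. *)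

theory Defs
  imports "HOL-Analysis.Analysis"
begin

text \<open>
  Real polynomials in \<open>x = (x\<^sub>1, \<dots>, x\<^sub>d)\<close> are represented by the functions they
  induce on \<open>\<real>\<^sup>d\<close>, that is, on \<^typ>\<open>real^'d\<close> with \<open>d = CARD('d)\<close>; since the reals are
  infinite, identities of polynomials are identities of these functions.
  The vector \<open>e\<^sub>i\<close> of the standard basis is \<^term>\<open>axis i (1::real)\<close>.

  The coefficients \<open>\<alpha> i j\<close> of a difference operator are only meaningful for \<open>i \<noteq> j\<close>;
  the diagonal values \<open>\<alpha> i i\<close> are left unconstrained everywhere below.
  In contrast, the diagonal constants \<open>l i i\<close> do enter the general form,
  through \<open>\<beta> i\<close> and \<open>\<gamma> i\<close>.
\<close>

definition compatibility_conditions ::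
  "('d::finite \<Rightarrow> 'd \<Rightarrow> real^'d \<Rightarrow> real) \<Rightarrow> ('d \<Rightarrow> real^'d \<Rightarrow> real) \<Rightarrow>
   ('d \<Rightarrow> real^'d \<Rightarrow> real) \<Rightarrow> bool" where
  "compatibility_conditions \<alpha> \<beta> \<gamma> \<longleftrightarrow>
    (\<forall>i j. i \<noteq> j \<longrightarrow>
      (\<forall>x. \<alpha> i j (x - axis i 1) * \<beta> j (x - axis j 1) * \<gamma> i x
         = \<alpha> j i (x - axis j 1) * \<beta> i (x - axis i 1) * \<gamma> j x) \<and>
      (\<forall>x. \<beta> i (x - axis i 1) * \<beta> j (x - axis i 1 - axis j 1) * \<gamma> j x * \<gamma> i (x - axis j 1)
         = \<beta> j (x - axis j 1) * \<beta> i (x - axis i 1 - axis j 1) * \<gamma> i x * \<gamma> j (x - axis i 1)))"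

definition general_form ::
  "real \<Rightarrow> ('d::finite \<Rightarrow> 'd \<Rightarrow> real) \<Rightarrow> ('d \<Rightarrow> real) \<Rightarrow>
   ('d \<Rightarrow> 'd \<Rightarrow> real^'d \<Rightarrow> real) \<Rightarrow> ('d \<Rightarrow> real^'d \<Rightarrow> real) \<Rightarrow>
   ('d \<Rightarrow> real^'d \<Rightarrow> real) \<Rightarrow> bool" where
  "general_form b l s \<alpha> \<beta> \<gamma> \<longleftrightarrow>
    (\<forall>i j. i \<noteq> j \<longrightarrow> (\<forall>x. \<alpha> i j x = x $ j * (x $ i - l i j))) \<and>
    (\<forall>i x. \<beta> i x = - (x $ i) * (\<Sum>k\<in>UNIV. x $ k) + (\<Sum>k\<in>UNIV. l i k * x $ k) + b * x $ i + s i) \<and>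
    (\<forall>i x. \<gamma> i x = x $ i * (- (\<Sum>k\<in>UNIV. x $ k) + (\<Sum>k\<in>UNIV. l k i)))"

definition solution1 ::
  "real \<Rightarrow> real \<Rightarrow> ('d::finite \<Rightarrow> real) \<Rightarrow>
   ('d \<Rightarrow> 'd \<Rightarrow> real^'d \<Rightarrow> real) \<Rightarrow> ('d \<Rightarrow> real^'d \<Rightarrow> real) \<Rightarrow>
   ('d \<Rightarrow> real^'d \<Rightarrow> real) \<Rightarrow> bool" where
  "solution1 b r l \<alpha> \<beta> \<gamma> \<longleftrightarrow>
    (\<forall>i j. i \<noteq> j \<longrightarrow> (\<forall>x. \<alpha> i j x = x $ j * (x $ i - l i))) \<and>
    (\<forall>i x. \<beta> i x = - (x $ i - l i) * ((\<Sum>k\<in>UNIV. x $ k) - b - r)) \<and>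
    (\<forall>i x. \<gamma> i x = - (x $ i) * ((\<Sum>k\<in>UNIV. x $ k) - (\<Sum>k\<in>UNIV. l k) - r))"

definition solution2 ::
  "real \<Rightarrow> ('d::finite \<Rightarrow> real) \<Rightarrow> ('d \<Rightarrow> real) \<Rightarrow>
   ('d \<Rightarrow> 'd \<Rightarrow> real^'d \<Rightarrow> real) \<Rightarrow> ('d \<Rightarrow> real^'d \<Rightarrow> real) \<Rightarrow>
   ('d \<Rightarrow> real^'d \<Rightarrow> real) \<Rightarrow> bool" where
  "solution2 b r l \<alpha> \<beta> \<gamma> \<longleftrightarrow>
    b = (\<Sum>k\<in>UNIV. l k) - 1 \<and>
    (\<forall>i j. i \<noteq> j \<longrightarrow> (\<forall>x. \<alpha> i j x = x $ j * (x $ i - l i))) \<and>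
    (\<forall>i x. \<beta> i x = - (x $ i - l i) * ((\<Sum>k\<in>UNIV. x $ k) - (\<Sum>k\<in>UNIV. l k) + 1 - r i)) \<and>
    (\<forall>i x. \<gamma> i x = - (x $ i) * ((\<Sum>k\<in>UNIV. x $ k) - (\<Sum>k\<in>UNIV. l k) - r i))"

end

theory Submission
  imports Defs
begin

text \<open>
  Write \<open>S = \<Sum>\<^sub>k x\<^sub>k\<close>.  Both families have the same factored shape, in which the first
  compatibility condition says \<open>(r\<^sub>i - r\<^sub>j) (b + 1 - \<Sum>\<^sub>k l\<^sub>k) = 0\<close>; this condition also gives
  the second one.  The converse needs only the first condition.  Cancelling the factors
  \<open>x\<^sub>i x\<^sub>j\<close> it reads
  \<open>(x\<^sub>i - 1 - l\<^sub>i\<^sub>j) (S - c\<^sub>i) \<beta>\<^sub>j(x - e\<^sub>j) = (x\<^sub>j - 1 - l\<^sub>j\<^sub>i) (S - c\<^sub>j) \<beta>\<^sub>i(x - e\<^sub>i)\<close>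
  with \<open>c\<^sub>i = \<Sum>\<^sub>k l\<^sub>k\<^sub>i\<close>.  The left-hand side vanishes on the hyperplane \<open>x\<^sub>i = l\<^sub>i\<^sub>j + 1\<close>, on which
  neither affine factor of the right-hand side is identically zero; hence \<open>\<beta>\<^sub>i\<close> vanishes on the
  hyperplane \<open>x\<^sub>i = l\<^sub>i\<^sub>j\<close> (\<open>beta_zero\<close>).  Comparing coefficients there, \<open>l\<^sub>i\<^sub>j = l\<^sub>i\<close> does
  not depend on \<open>j \<noteq> i\<close>, and \<open>\<beta>\<^sub>i = - (x\<^sub>i - l\<^sub>i) (S - b - r\<^sub>i)\<close> with \<open>r\<^sub>i = l\<^sub>i\<^sub>i - l\<^sub>i\<close>, while
  \<open>c\<^sub>i = L + r\<^sub>i\<close> with \<open>L = \<Sum>\<^sub>k l\<^sub>k\<close>.  Substituting this back, the condition becomes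
  \<open>(r\<^sub>i - r\<^sub>j) (b + 1 - L) = 0\<close>.  Either all \<open>r\<^sub>i\<close> agree, which is the first family, or
  \<open>b = L - 1\<close>, which is the second.
\<close>

lemma sum_axis [simp]: "(\<Sum>k\<in>UNIV. axis i (a::real) $ k) = a"
  by (simp add: axis_def)

text \<open>
  The form in which polynomial identities are cancelled: a factor that is affine and nonconstant
  along a line through \<open>x\<close> has at most one zero on it, so that the cofactor vanishes at \<open>x\<close>
  by continuity even if the factor itself is zero there.
\<close>

lemma cancel_affine_factor:
  fixes f g :: "real^'d::finite \<Rightarrow> real"
  assumes f: "continuous_on UNIV f"
    and g: "\<And>t. g (x + t *\<^sub>R v) = g x + t * m" and "m \<noteq> 0"
    and zero: "\<And>t. g (x + t *\<^sub>R v) * f (x + t *\<^sub>R v) = 0"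
  shows "f x = 0"
proof -
  have "isCont (\<lambda>t. f (x + t *\<^sub>R v)) 0"
    using continuous_on_compose2[OF f, of UNIV "\<lambda>t. x + t *\<^sub>R v"]
    by (simp add: continuous_intros continuous_on_eq_continuous_at)
  then have "((\<lambda>t. f (x + t *\<^sub>R v)) \<longlongrightarrow> f x) (at 0)"
    by (simp add: isCont_def)
  moreover have "\<forall>\<^sub>F t in at 0. f (x + t *\<^sub>R v) = 0"
    using eventually_neq_at_within[of "- g x / m"]
  proof eventually_elim
    case (elim t)
    then have "g x + t * m \<noteq> 0"
      using \<open>m \<noteq> 0\<close> by (auto simp: field_simps add_eq_0_iff)
    then show ?case using zero[of t] g[of t] by simp
  qed
  then have "((\<lambda>t. f (x + t *\<^sub>R v)) \<longlongrightarrow> 0) (at 0)"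
    by (rule tendsto_eventually)
  ultimately show ?thesis
    using tendsto_unique trivial_limit_at by blast
qed

text \<open>
  The common shape of both families, with \<open>b\<close>, \<open>r\<^sub>i\<close> and \<open>l\<^sub>i\<close> unrelated.  It satisfies the
  compatibility conditions if \<open>(r\<^sub>i - r\<^sub>j) (b + 1 - \<Sum>\<^sub>k l\<^sub>k) = 0\<close> for all \<open>i\<close>, \<open>j\<close>.  Again only the values \<open>\<alpha> i j\<close> with \<open>i \<noteq> j\<close> are prescribed.
\<close>

definition factored_form ::
  "real \<Rightarrow> ('d::finite \<Rightarrow> real) \<Rightarrow> ('d \<Rightarrow> real) \<Rightarrow>
   ('d \<Rightarrow> 'd \<Rightarrow> real^'d \<Rightarrow> real) \<Rightarrow> ('d \<Rightarrow> real^'d \<Rightarrow> real) \<Rightarrow>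
   ('d \<Rightarrow> real^'d \<Rightarrow> real) \<Rightarrow> bool" where
  "factored_form b r l \<alpha> \<beta> \<gamma> \<longleftrightarrow>
    (\<forall>i j. i \<noteq> j \<longrightarrow> (\<forall>x. \<alpha> i j x = x $ j * (x $ i - l i))) \<and>
    (\<forall>i x. \<beta> i x = - (x $ i - l i) * ((\<Sum>k\<in>UNIV. x $ k) - b - r i)) \<and>
    (\<forall>i x. \<gamma> i x = - (x $ i) * ((\<Sum>k\<in>UNIV. x $ k) - (\<Sum>k\<in>UNIV. l k) - r i))"

lemma solution1_iff_factored_form:
  "solution1 b r l \<alpha> \<beta> \<gamma> \<longleftrightarrow> factored_form b (\<lambda>_. r) l \<alpha> \<beta> \<gamma>"
  by (simp add: solution1_def factored_form_def)

lemma solution2_iff_factored_form: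
  "solution2 b r l \<alpha> \<beta> \<gamma> \<longleftrightarrow> b = (\<Sum>k\<in>UNIV. l k) - 1 \<and> factored_form b r l \<alpha> \<beta> \<gamma>"
  by (auto simp: solution2_def factored_form_def diff_diff_eq2)

lemma sum_l_factored:
  fixes x :: "real^'d::finite" and l :: "'d \<Rightarrow> real"
  shows "(\<Sum>k\<in>UNIV. (l i + (if k = i then r else 0)) * x $ k) = l i * (\<Sum>k\<in>UNIV. x $ k) + r * x $ i"
  by (simp add: distrib_right sum.distrib sum_distrib_left if_distrib[of "\<lambda>y. y * _"] cong: if_cong)

text \<open>The parameters \<open>r\<^sub>i\<close> are absorbed into the diagonal: \<open>l\<^sub>i\<^sub>i = l\<^sub>i + r\<^sub>i\<close>.\<close>

lemma factored_form_imp_general_form: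
  fixes \<alpha> :: "'d::finite \<Rightarrow> 'd \<Rightarrow> real^'d \<Rightarrow> real"
  assumes "factored_form b r l \<alpha> \<beta> \<gamma>"
  shows "\<exists>l s. general_form b l s \<alpha> \<beta> \<gamma>"
proof (intro exI)
  let ?l = "\<lambda>i k. l i + (if k = i then r i else 0)"
  have "(\<Sum>k\<in>UNIV. ?l k i) = (\<Sum>k\<in>UNIV. l k) + r i" for i
    by (simp add: sum.distrib)
  then show "general_form b ?l (\<lambda>i. - l i * (b + r i)) \<alpha> \<beta> \<gamma>"
    using assms unfolding general_form_def factored_form_def sum_l_factored
    by (simp add: algebra_simps)
qed

lemma factored_form_imp_compatible:
  fixes \<alpha> :: "'d::finite \<Rightarrow> 'd \<Rightarrow> real^'d \<Rightarrow> real"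
  assumes ff: "factored_form b r l \<alpha> \<beta> \<gamma>"
    and r: "\<And>i j. (r i - r j) * (b + 1 - (\<Sum>k\<in>UNIV. l k)) = 0"
  shows "compatibility_conditions \<alpha> \<beta> \<gamma>"
  unfolding compatibility_conditions_def
proof (intro allI impI conjI)
  fix i j :: 'd and x :: "real^'d"
  assume ij: "i \<noteq> j"
  define S where "S = (\<Sum>k\<in>UNIV. x $ k)"
  define L where "L = (\<Sum>k\<in>UNIV. l k)"
  have \<alpha>: "\<alpha> i j (x - axis i 1) = x $ j * (x $ i - 1 - l i)"
    "\<alpha> j i (x - axis j 1) = x $ i * (x $ j - 1 - l j)"
    using ff ij by (simp_all add: factored_form_def axis_def)
  have \<beta>: "\<beta> i (x - axis i 1) = - (x $ i - 1 - l i) * (S - 1 - b - r i)"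
    "\<beta> j (x - axis j 1) = - (x $ j - 1 - l j) * (S - 1 - b - r j)"
    "\<beta> j (x - axis i 1 - axis j 1) = - (x $ j - 1 - l j) * (S - 2 - b - r j)"
    "\<beta> i (x - axis i 1 - axis j 1) = - (x $ i - 1 - l i) * (S - 2 - b - r i)"
    using ff ij by (simp_all add: factored_form_def sum_subtractf S_def) (simp_all add: axis_def)
  have \<gamma>: "\<gamma> i x = - (x $ i) * (S - L - r i)" "\<gamma> j x = - (x $ j) * (S - L - r j)"
    "\<gamma> i (x - axis j 1) = - (x $ i) * (S - 1 - L - r i)"
    "\<gamma> j (x - axis i 1) = - (x $ j) * (S - 1 - L - r j)"
    using ff ij by (simp_all add: factored_form_def sum_subtractf S_def L_def) (simp_all add: axis_def)
  consider "r i = r j" | "b = L - 1"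
    using r[of i j] by (force simp: L_def)
  note cases = this
  have rearrange1: "x * u * (- v * p) * (- y * q) = y * v * (- u * p') * (- x * q')"
    if "p * q = p' * q'" for x y u v p q p' q' :: real
    using that by algebra
  have rearrange2: "(- u * p) * (- v * q) * (- y * s) * (- x * t) = (- v * p') * (- u * q') * (- x * s') * (- y * t')"
    if "p * q * s * t = p' * q' * s' * t'" for x y u v p q s t p' q' s' t' :: real
    using that by algebra
  show "\<alpha> i j (x - axis i 1) * \<beta> j (x - axis j 1) * \<gamma> i x
      = \<alpha> j i (x - axis j 1) * \<beta> i (x - axis i 1) * \<gamma> j x"
    unfolding \<alpha> \<beta> \<gamma>
  proof (rule rearrange1)
    show "(S - 1 - b - r j) * (S - L - r i) = (S - 1 - b - r i) * (S - L - r j)"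
      using cases by cases simp_all
  qed
  show "\<beta> i (x - axis i 1) * \<beta> j (x - axis i 1 - axis j 1) * \<gamma> j x * \<gamma> i (x - axis j 1)
      = \<beta> j (x - axis j 1) * \<beta> i (x - axis i 1 - axis j 1) * \<gamma> i x * \<gamma> j (x - axis i 1)"
    unfolding \<alpha> \<beta> \<gamma>
  proof (rule rearrange2)
    show "(S - 1 - b - r i) * (S - 2 - b - r j) * (S - L - r j) * (S - 1 - L - r i)
        = (S - 1 - b - r j) * (S - 2 - b - r i) * (S - L - r i) * (S - 1 - L - r j)"
      using cases
    proof cases
      case 2
      then have "S - 1 - b = S - L" "S - 2 - b = S - 1 - L" by simp_all
      then show ?thesis by (simp only: mult_ac)
    qed simp
  qed
qed

lemma continuous_beta:
  assumes "general_form b l s \<alpha> \<beta> \<gamma>"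
  shows "continuous_on A (\<beta> i)"
proof -
  have "\<beta> i = (\<lambda>x. - (x $ i) * (\<Sum>k\<in>UNIV. x $ k) + (\<Sum>k\<in>UNIV. l i k * x $ k) + b * x $ i + s i)"
    using assms by (auto simp: general_form_def)
  then show ?thesis by (simp only:) (intro continuous_intros)
qed

text \<open>The first compatibility condition with the common factor \<open>x\<^sub>i x\<^sub>j\<close> cancelled.\<close>

lemma first_condition_cancelled:
  fixes \<alpha> :: "'d::finite \<Rightarrow> 'd \<Rightarrow> real^'d \<Rightarrow> real"
  assumes gf: "general_form b l s \<alpha> \<beta> \<gamma>" and cc: "compatibility_conditions \<alpha> \<beta> \<gamma>"
    and ij: "i \<noteq> j"
  shows "(x $ i - 1 - l i j) * ((\<Sum>k\<in>UNIV. x $ k) - (\<Sum>k\<in>UNIV. l k i)) * \<beta> j (x - axis j 1)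
       = (x $ j - 1 - l j i) * ((\<Sum>k\<in>UNIV. x $ k) - (\<Sum>k\<in>UNIV. l k j)) * \<beta> i (x - axis i 1)"
proof -
  define F where "F x =
      (x $ i - 1 - l i j) * ((\<Sum>k\<in>UNIV. x $ k) - (\<Sum>k\<in>UNIV. l k i)) * \<beta> j (x - axis j 1)
    - (x $ j - 1 - l j i) * ((\<Sum>k\<in>UNIV. x $ k) - (\<Sum>k\<in>UNIV. l k j)) * \<beta> i (x - axis i 1)" for x
  have \<beta>: "continuous_on UNIV (\<lambda>x. \<beta> k (x - axis k' 1))" for k k'
    by (rule continuous_on_compose2[OF continuous_beta[OF gf, of UNIV]]) (auto intro!: continuous_intros)
  have F: "continuous_on UNIV F"
    unfolding F_def by (intro continuous_intros \<beta>)
  have prod: "x $ i * (x $ j * F x) = 0" for x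
  proof -
    have "\<alpha> i j (x - axis i 1) * \<beta> j (x - axis j 1) * \<gamma> i x
        = \<alpha> j i (x - axis j 1) * \<beta> i (x - axis i 1) * \<gamma> j x"
      using cc ij by (simp add: compatibility_conditions_def)
    moreover have "\<alpha> i j (x - axis i 1) = x $ j * (x $ i - 1 - l i j)"
      "\<alpha> j i (x - axis j 1) = x $ i * (x $ j - 1 - l j i)"
      "\<gamma> i x = - x $ i * ((\<Sum>k\<in>UNIV. x $ k) - (\<Sum>k\<in>UNIV. l k i))"
      "\<gamma> j x = - x $ j * ((\<Sum>k\<in>UNIV. x $ k) - (\<Sum>k\<in>UNIV. l k j))"
      using gf ij by (simp_all add: general_form_def) (simp_all add: axis_def algebra_simps)
    ultimately show ?thesis unfolding F_def by algebra
  qed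
  have Fj: "x $ j * F x = 0" for x
  proof (rule cancel_affine_factor[where g = "\<lambda>x. x $ i" and v = "axis i 1" and m = 1])
    show "continuous_on UNIV (\<lambda>x. x $ j * F x)" by (intro continuous_intros F)
    show "(x + t *\<^sub>R axis i 1) $ i *
        ((x + t *\<^sub>R axis i 1) $ j * F (x + t *\<^sub>R axis i 1)) = 0" for t
      by (rule prod)
  qed simp_all
  have "F x = 0"
    by (rule cancel_affine_factor[OF F _ _ Fj, where v = "axis j 1" and m = 1]) simp_all
  then show ?thesis by (simp add: F_def)
qed

lemma beta_zero:
  fixes \<alpha> :: "'d::finite \<Rightarrow> 'd \<Rightarrow> real^'d \<Rightarrow> real"
  assumes gf: "general_form b l s \<alpha> \<beta> \<gamma>" and cc: "compatibility_conditions \<alpha> \<beta> \<gamma>"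
    and ij: "i \<noteq> j" and y: "y $ i = l i j"
  shows "\<beta> i y = 0"
proof -
  \<comment> \<open>At \<open>z + e\<^sub>i\<close> with \<open>z $ i = l i j\<close> the left-hand side of the cancelled condition is zero.
    Its right-hand side is \<open>\<beta> i z\<close> times two factors, one of them \<open>h z\<close>, that are not
    constant along \<open>e\<^sub>j\<close>, a direction inside this hyperplane.\<close>
  define h where "h z = (\<Sum>k\<in>UNIV. z $ k) + 1 - (\<Sum>k\<in>UNIV. l k j)" for z :: "real^'d"
  have h: "h (z + t *\<^sub>R axis j 1) = h z + t * 1" for z t
    by (simp add: h_def sum.distrib flip: sum_distrib_left)
  have line: "(z + t *\<^sub>R axis j 1) $ i = l i j" if "z $ i = l i j" for z :: "real^'d" and t
    using that ij by (simp add: axis_def)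
  have prod: "(z $ j - 1 - l j i) * (h z * \<beta> i z) = 0" if z: "z $ i = l i j" for z
    using first_condition_cancelled[OF gf cc ij, of "z + axis i 1"] z ij
    by (simp add: h_def sum.distrib axis_def)
  have hb: "h z * \<beta> i z = 0" if z: "z $ i = l i j" for z
  proof (rule cancel_affine_factor[where g = "\<lambda>x. x $ j - 1 - l j i" and v = "axis j 1" and m = 1])
    show "continuous_on UNIV (\<lambda>z. h z * \<beta> i z)"
      unfolding h_def by (intro continuous_intros continuous_beta[OF gf])
    show "((z + t *\<^sub>R axis j 1) $ j - 1 - l j i) *
        (h (z + t *\<^sub>R axis j 1) * \<beta> i (z + t *\<^sub>R axis j 1)) = 0" for t
      by (rule prod[OF line[OF z]])
  qed simp_all
  show ?thesis
    by (rule cancel_affine_factor[OF continuous_beta[OF gf] h _ hb[OF line[OF y]]]) simp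
qed

text \<open>
  These are the coefficients of \<open>\<beta>\<^sub>i\<close> on the hyperplane \<open>x\<^sub>i = l\<^sub>i\<^sub>j\<close>, where it vanishes: the
  constant term, and the coefficient \<open>l\<^sub>i\<^sub>k - l\<^sub>i\<^sub>j\<close> of \<open>x\<^sub>k\<close>.
\<close>

lemma l_eq_and_s_eq:
  fixes \<alpha> :: "'d::finite \<Rightarrow> 'd \<Rightarrow> real^'d \<Rightarrow> real"
  assumes gf: "general_form b l s \<alpha> \<beta> \<gamma>" and cc: "compatibility_conditions \<alpha> \<beta> \<gamma>"
    and ij: "i \<noteq> j"
  shows "s i = l i j * (l i j - l i i - b)" and "k \<noteq> i \<Longrightarrow> l i k = l i j"
proof -
  have \<beta>: "\<beta> i x = - (x $ i) * (\<Sum>k\<in>UNIV. x $ k) + (\<Sum>k\<in>UNIV. l i k * x $ k) + b * x $ i + s i" for x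
    using gf by (simp add: general_form_def)
  have sum_l: "(\<Sum>k\<in>UNIV. l i k * axis m a $ k) = l i m * a" for m a
    by (simp add: axis_def if_distrib[of "\<lambda>y. _ * y"] cong: if_cong)
  have "\<beta> i (axis i (l i j)) = 0"
    by (rule beta_zero[where y = "axis i (l i j)", OF gf cc ij]) simp
  then show s: "s i = l i j * (l i j - l i i - b)"
    unfolding \<beta> by (simp add: sum_l algebra_simps)
  assume k: "k \<noteq> i"
  have "\<beta> i (axis i (l i j) + axis k 1) = 0"
    by (rule beta_zero[where y = "axis i (l i j) + axis k 1", OF gf cc ij]) (use k in \<open>simp add: axis_def\<close>)
  moreover have "(axis i (l i j) + axis k 1) $ i = l i j"
    using k by (simp add: axis_def)
  ultimately show "l i k = l i j"
    unfolding \<beta> by (simp add: sum_l sum.distrib distrib_left s algebra_simps)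
qed

lemma compatible_imp_solution:
  fixes \<alpha> :: "'d::finite \<Rightarrow> 'd \<Rightarrow> real^'d \<Rightarrow> real"
  assumes card: "CARD('d) > 1"
    and gf: "general_form b l s \<alpha> \<beta> \<gamma>" and cc: "compatibility_conditions \<alpha> \<beta> \<gamma>"
  shows "(\<exists>r l. solution1 b r l \<alpha> \<beta> \<gamma>) \<or> (\<exists>r l. solution2 b r l \<alpha> \<beta> \<gamma>)"
proof -
  have "\<exists>j. j \<noteq> i" for i :: 'd
  proof (rule ccontr)
    assume "\<nexists>j. j \<noteq> i"
    then have "(UNIV :: 'd set) = {i}" by auto
    then have "CARD('d) = card {i}" by (rule arg_cong)
    with card show False by simp
  qed
  then obtain \<sigma> :: "'d \<Rightarrow> 'd" where \<sigma>: "\<And>i. \<sigma> i \<noteq> i" by metis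
  \<comment> \<open>By \<open>l_eq_and_s_eq\<close> the off-diagonal values \<open>l i j\<close> depend on \<open>i\<close> only, so that any
    \<open>j \<noteq> i\<close> may be chosen; \<open>CARD('d) > 1\<close> provides one.\<close>
  define \<mu> where "\<mu> i = l i (\<sigma> i)" for i
  define r where "r i = l i i - \<mu> i" for i
  define L where "L = (\<Sum>k\<in>UNIV. \<mu> k)"
  have l: "l i k = \<mu> i + (if k = i then r i else 0)" for i k
    using l_eq_and_s_eq(2)[OF gf cc, of i "\<sigma> i" k] \<sigma>[of i] by (auto simp: \<mu>_def r_def)
  have s: "s i = - \<mu> i * (r i + b)" for i
    using l_eq_and_s_eq(1)[OF gf cc, of i "\<sigma> i"] \<sigma>[of i] by (simp add: \<mu>_def r_def algebra_simps)
  have \<alpha>: "\<alpha> i j x = x $ j * (x $ i - \<mu> i)" if "i \<noteq> j" for i j x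
    using gf that l[of i j] by (simp add: general_form_def)
  have c: "(\<Sum>k\<in>UNIV. l k i) = L + r i" for i
    by (simp add: l sum.distrib L_def)
  have \<gamma>: "\<gamma> i x = - (x $ i) * ((\<Sum>k\<in>UNIV. x $ k) - L - r i)" for i x
    using gf by (simp add: general_form_def c algebra_simps)
  have \<beta>: "\<beta> i x = - (x $ i - \<mu> i) * ((\<Sum>k\<in>UNIV. x $ k) - b - r i)" for i x
    using gf unfolding general_form_def l sum_l_factored by (simp add: s algebra_simps)
  have ff: "factored_form b r \<mu> \<alpha> \<beta> \<gamma>"
    unfolding factored_form_def L_def[symmetric] by (simp add: \<alpha> \<beta> \<gamma>)
  have key: "(r i - r j) * (b + 1 - L) = 0" if ij: "i \<noteq> j" for i j
  proof -
    \<comment> \<open>A point with \<open>S = 0\<close> off the hyperplanes \<open>x $ i = \<mu> i + 1\<close> and \<open>x $ j = \<mu> j + 1\<close>.\<close>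
    define a where "a = \<mu> i + \<mu> j + 2"
    define p where "p = \<bar>a\<bar> + 1"
    define q where "q = - a - p"
    define x :: "real^'d" where "x = axis i (\<mu> i + 1 + p) + axis j (\<mu> j + 1 + q)"
    have "p * q \<noteq> 0" by (auto simp: p_def q_def)
    have x: "x $ i = \<mu> i + 1 + p" "x $ j = \<mu> j + 1 + q"
      using ij by (simp_all add: x_def axis_def)
    have S: "(\<Sum>k\<in>UNIV. x $ k) = 0"
      by (simp add: x_def sum.distrib q_def a_def)
    have "l i j = \<mu> i" "l j i = \<mu> j" using ij by (simp_all add: l)
    with first_condition_cancelled[OF gf cc ij, of x]
    have "p * (L + r i) * (q * (1 + b + r j)) = q * (L + r j) * (p * (1 + b + r i))"
      by (simp add: c \<beta> x S sum_subtractf algebra_simps)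
    then have "(p * q) * ((r i - r j) * (b + 1 - L)) = 0" by algebra
    with \<open>p * q \<noteq> 0\<close> show ?thesis by simp
  qed
  show ?thesis
  proof (cases "b = L - 1")
    case True
    with ff show ?thesis by (auto simp: solution2_iff_factored_form L_def)
  next
    case False
    then have "r i = r undefined" for i
      using key[of i undefined] by (cases "i = undefined") auto
    then have "r = (\<lambda>_. r undefined)" by blast
    with ff show ?thesis by (metis solution1_iff_factored_form)
  qed
qed

theorem proposition5p1:
  fixes \<alpha> :: "'d::finite \<Rightarrow> 'd \<Rightarrow> real^'d \<Rightarrow> real"
    and \<beta> \<gamma> :: "'d \<Rightarrow> real^'d \<Rightarrow> real"
    and b :: real
  assumes "CARD('d) > 1"
  shows "(\<exists>l s. general_form b l s \<alpha> \<beta> \<gamma>) \<and> compatibility_conditions \<alpha> \<beta> \<gamma>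
    \<longleftrightarrow> (\<exists>r l. solution1 b r l \<alpha> \<beta> \<gamma>) \<or> (\<exists>r l. solution2 b r l \<alpha> \<beta> \<gamma>)"
proof
  assume "(\<exists>l s. general_form b l s \<alpha> \<beta> \<gamma>) \<and> compatibility_conditions \<alpha> \<beta> \<gamma>"
  then show "(\<exists>r l. solution1 b r l \<alpha> \<beta> \<gamma>) \<or> (\<exists>r l. solution2 b r l \<alpha> \<beta> \<gamma>)"
    using compatible_imp_solution[OF assms] by blast
next
  assume "(\<exists>r l. solution1 b r l \<alpha> \<beta> \<gamma>) \<or> (\<exists>r l. solution2 b r l \<alpha> \<beta> \<gamma>)"
  then obtain r l where "factored_form b r l \<alpha> \<beta> \<gamma>"
    and "\<And>i j. (r i - r j) * (b + 1 - (\<Sum>k\<in>UNIV. l k)) = 0"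
    by (auto simp: solution1_iff_factored_form solution2_iff_factored_form)
  then show "(\<exists>l s. general_form b l s \<alpha> \<beta> \<gamma>) \<and> compatibility_conditions \<alpha> \<beta> \<gamma>"
    using factored_form_imp_general_form factored_form_imp_compatible by blast
qed

end
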